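(* Let $\mathcal{F}$ be a family of compact convex sets in $\mathbb{R}^d$. If among every $\aleph_0$ members of $\mathcal{F}$ some $d+1$ contain a point in their intersection with integer coordinates, then all the members of $\mathcal{F}$ can be hit by finitely many points with integer coordinates.
   Context: The hypothesis means that among any infinitely many members of $\mathcal{F}$ there are $d+1$ whose common intersection contains a point of $\mathbb{Z}^d$. A set is hit by a point if it contains that point.
   Formalization: The formal statement additionally assumes that every member of the family contains a point with integer coordinates; without this the claim fails, e.g. for the family consisting of the single set {(1/2,…,1/2)}, where the hypothesis is vacuous. *)

theory Defs
  imports "HOL-Analysis.Analysis"
begin

definition integer_points :: "(real ^ 'n) set" where
  "integer_points = {x. \<forall>i. x $ i \<in> \<int>}"

text \<open>The members of a subfamily are counted as distinct sets; \<open>card K = q\<close> with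
  \<open>q > 0\<close> forces \<open>K\<close> to be finite and nonempty, so \<open>\<Inter>K\<close> is a genuine intersection.\<close>

definition aleph0_property :: "'a set \<Rightarrow> nat \<Rightarrow> 'a set set \<Rightarrow> bool" where
  "aleph0_property P q F \<longleftrightarrow>
     (\<forall>G. G \<subseteq> F \<and> countable G \<and> infinite G \<longrightarrow>
        (\<exists>K. K \<subseteq> G \<and> card K = q \<and> \<Inter>K \<inter> P \<noteq> {}))"

definition finitely_hit :: "'a set \<Rightarrow> 'a set set \<Rightarrow> bool" where
  "finitely_hit P F \<longleftrightarrow>
     (\<exists>H. finite H \<and> H \<subseteq> P \<and> (\<forall>A\<in>F. \<exists>h\<in>H. h \<in> A))"

text \<open>The property above says nothing about any finite number of members, so a member free of
  integer points can never be excluded by it, while such a member cannot be hit: the family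
  consisting of the single set \<open>{\<chi> i. 1/2}\<close> satisfies it vacuously.  The statement about
  integer points therefore has to be read for families each of whose members contains some
  integer point.\<close>

end

theory Submission
  imports Defs
begin

text \<open>A compact set contains only finitely many integer points.  Choose a maximal subfamily
  \<open>M\<close> whose members are pairwise disjoint on the integer lattice.  If \<open>M\<close> were infinite, the
  hypothesis would give \<open>d + 1 \<ge> 2\<close> members of \<open>M\<close> with a common integer point.  So \<open>M\<close> is
  finite, and by maximality the finitely many integer points of its members hit every member
  of the family.\<close>

text \<open>Each coordinate of such a point is an integer of absolute value at most a norm bound
  \<open>b\<close>, which leaves finitely many choices per coordinate.\<close>

lemma finite_bounded_integer_points:
  fixes A :: "(real ^ 'n) set"
  assumes "bounded A"
  shows "finite (A \<inter> integer_points)"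
proof -
  obtain b where b: "\<And>x. x \<in> A \<Longrightarrow> norm x \<le> b"
    using assms by (auto simp: bounded_iff)
  let ?S = "{k :: real. k \<in> \<int> \<and> \<bar>k\<bar> \<le> b}"
  have "finite (PiE (UNIV :: 'n set) (\<lambda>_. ?S))"
    by (intro finite_PiE finite_abs_int_segment) simp
  moreover have "A \<inter> integer_points \<subseteq> vec_lambda ` PiE UNIV (\<lambda>_. ?S)"
  proof
    fix x assume "x \<in> A \<inter> integer_points"
    then have "vec_nth x \<in> PiE UNIV (\<lambda>_. ?S)"
      using order_trans[OF component_le_norm_cart b] by (auto simp: integer_points_def PiE_iff)
    then show "x \<in> vec_lambda ` PiE UNIV (\<lambda>_. ?S)"
      by (intro image_eqI[of _ _ "vec_nth x"]) (simp_all add: vec_nth_inverse)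
  qed
  ultimately show ?thesis
    by (rule finite_surj)
qed

text \<open>Zorn's lemma applies since any two elements of the union of a chain already lie in one
  member of the chain.\<close>

lemma maximal_pairwise_subset:
  "\<exists>M\<subseteq>F. pairwise R M \<and> (\<forall>x\<in>F. pairwise R (insert x M) \<longrightarrow> x \<in> M)"
proof -
  let ?A = "{M. M \<subseteq> F \<and> pairwise R M}"
  have "\<exists>M\<in>?A. \<forall>X\<in>?A. M \<subseteq> X \<longrightarrow> X = M"
  proof (rule subset_Zorn')
    fix C assume "subset.chain ?A C"
    then have "C \<subseteq> ?A" "chain\<^sub>\<subseteq> C"
      by (simp_all add: subset_chain_def chain_subset_def)
    then show "\<Union>C \<in> ?A"
      using pairwise_chain_Union[of C R] by blast
  qed
  then obtain M where M: "M \<subseteq> F" "pairwise R M"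
    and max: "\<And>X. X \<subseteq> F \<Longrightarrow> pairwise R X \<Longrightarrow> M \<subseteq> X \<Longrightarrow> X = M"
    by auto
  have "x \<in> M" if "x \<in> F" "pairwise R (insert x M)" for x
  proof -
    have "insert x M = M"
      using M(1) that by (intro max) auto
    then show "x \<in> M" by blast
  qed
  with M show ?thesis by auto
qed

lemma finitely_hit_if_aleph0_property:
  assumes fin: "\<And>A. A \<in> F \<Longrightarrow> finite (A \<inter> P)"
    and ne: "\<And>A. A \<in> F \<Longrightarrow> A \<inter> P \<noteq> {}"
    and al: "aleph0_property P q F" and q: "q \<ge> 2"
  shows "finitely_hit P F"
proof -
  define R where "R = (\<lambda>A B. A \<inter> B \<inter> P = {})"
  obtain M where M: "M \<subseteq> F" "pairwise R M"
    and max: "\<And>A. A \<in> F \<Longrightarrow> pairwise R (insert A M) \<Longrightarrow> A \<in> M"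
    using maximal_pairwise_subset[of F R] by auto
  have finM: "finite M"
  proof (rule ccontr)
    assume "infinite M"
    then obtain G where G: "G \<subseteq> M" "countable G" "infinite G"
      by (meson infinite_countable_subset')
    then obtain K where K: "K \<subseteq> G" "card K = q" "\<Inter>K \<inter> P \<noteq> {}"
      using al M(1) unfolding aleph0_property_def by (meson subset_trans)
    \<comment> \<open>Here \<open>q \<ge> 2\<close> yields two distinct members of \<open>K\<close>;
      finiteness rules out the default cardinality 0 of infinite sets.\<close>
    then have "\<not> card K \<le> Suc 0" "finite K"
      using q by (auto intro: card_ge_0_finite)
    then obtain A B where "A \<in> K" "B \<in> K" "A \<noteq> B"
      by (auto simp: card_le_Suc0_iff_eq)
    moreover from this have "R A B"
      using M(2) K(1) G(1) by (meson pairwiseD subsetD)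
    ultimately show False
      using K(3) by (auto simp: R_def)
  qed
  have "\<exists>h\<in>\<Union>M \<inter> P. h \<in> A" if A: "A \<in> F" for A
  proof (rule ccontr)
    assume no: "\<not> ?thesis"
    then have "pairwise R (insert A M)"
      using M(2) by (auto simp: pairwise_insert R_def)
    \<comment> \<open>Maximality puts \<open>A\<close> itself into \<open>M\<close>, so any point of
      the nonempty set \<open>A \<inter> P\<close> is one of the chosen points and hits
      \<open>A\<close>.\<close>
    then show False
      using max[OF A] ne[OF A] no by blast
  qed
  moreover have "finite (\<Union>M \<inter> P)"
    unfolding Int_Union2 using finM fin M(1) by blast
  ultimately show ?thesis
    unfolding finitely_hit_def by (intro exI[of _ "\<Union>M \<inter> P"] conjI ballI) simp_all
qed

theorem corollary7:
  fixes F :: "(real ^ 'n) set set"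
  assumes "\<And>A. A \<in> F \<Longrightarrow> compact A \<and> convex A"
    and "\<And>A. A \<in> F \<Longrightarrow> A \<inter> integer_points \<noteq> {}"
    and "aleph0_property integer_points (CARD('n) + 1) F"
  shows "finitely_hit integer_points F"
proof (rule finitely_hit_if_aleph0_property[OF _ assms(2,3)])
  show "finite (A \<inter> integer_points)" if "A \<in> F" for A
    using assms(1)[OF that] by (intro finite_bounded_integer_points compact_imp_bounded) blast
  \<comment> \<open>The dimension is at least 1 because the index type is nonempty.\<close>
  show "2 \<le> CARD('n) + 1"
    using zero_less_card_finite[where 'a = 'n] by simp
qed

end
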